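(* $z_5\ge 5/9$.
   Context: Given an edge-coloring $c$ (an arbitrary assignment of colors to edges) of the complete graph $K_n$, let $z(n,c,s)$ be the fraction of the $n$ vertices that are incident with at least one edge of color $s$, and let $z(n,c)$ be the maximum of $z(n,c,s)$ over all colors $s$ appearing in $c$. Let $z_k(n)$ be the minimum of $z(n,c)$ over all edge-colorings $c$ of $K_n$ that use at most $k$ colors, and let $z_k=\inf_{n\ge 2} z_k(n)$. *)

theory Defs
  imports Complex_Main "HOL-Library.Ramsey"
begin

(* The vertices of K_n are 0, ..., n-1; its edges are the two-element sets of vertices.
   A coloring is a total function on sets of naturals, of which only the values on
   edges matter. *)

definition K_edges :: "nat \<Rightarrow> nat set set" where
  "K_edges n = [{..<n}]\<^bsup>2\<^esup>"

definition color_fraction :: "nat \<Rightarrow> (nat set \<Rightarrow> 'c) \<Rightarrow> 'c \<Rightarrow> real" where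
  "color_fraction n c s =
     real (card {v \<in> {..<n}. \<exists>e \<in> K_edges n. v \<in> e \<and> c e = s}) / real n"

definition max_color_fraction :: "nat \<Rightarrow> (nat set \<Rightarrow> 'c) \<Rightarrow> real" where
  "max_color_fraction n c = Max (color_fraction n c ` (c ` K_edges n))"

(* Colors are naturals; by min_color_fraction_le below, no other type of colors
   gives a smaller minimum. *)

definition min_color_fraction :: "nat \<Rightarrow> nat \<Rightarrow> real" where
  "min_color_fraction k n =
     Min {max_color_fraction n c | c :: nat set \<Rightarrow> nat. card (c ` K_edges n) \<le> k}"

definition z_inf :: "nat \<Rightarrow> real" where
  "z_inf k = (INF n\<in>{2..}. min_color_fraction k n)"

(* The maximum, the minimum and the infimum above are genuine for n >= 2 and k >= 1:
   the sets are nonempty, and finite or bounded below respectively. *)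

lemma finite_K_edges [simp]: "finite (K_edges n)"
  by (simp add: K_edges_def finite_imp_finite_nsets)

lemma K_edges_nonempty: "n \<ge> 2 \<Longrightarrow> K_edges n \<noteq> {}"
proof -
  assume "n \<ge> 2"
  then have "{0, 1} \<in> K_edges n"
    unfolding K_edges_def by (subst doubleton_in_nsets_2) auto
  then show ?thesis by blast
qed

lemma max_color_fraction_in:
  assumes "n \<ge> 2"
  shows "max_color_fraction n c \<in> (\<lambda>m. real m / real n) ` {..n}"
proof -
  have "max_color_fraction n c \<in> color_fraction n c ` (c ` K_edges n)"
    unfolding max_color_fraction_def using K_edges_nonempty[OF assms] by (intro Max_in) auto
  then obtain s where s: "max_color_fraction n c = color_fraction n c s"
    by blast
  have "card {v \<in> {..<n}. \<exists>e \<in> K_edges n. v \<in> e \<and> c e = s} \<le> card {..<n}"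
    by (rule card_mono) auto
  then show ?thesis
    unfolding s color_fraction_def by (intro imageI) simp
qed

lemma finite_max_color_fractions:
  "n \<ge> 2 \<Longrightarrow> finite {max_color_fraction n c | c :: nat set \<Rightarrow> nat. card (c ` K_edges n) \<le> k}"
  by (rule finite_subset[of _ "(\<lambda>m. real m / real n) ` {..n}"])
     (use max_color_fraction_in in blast, simp)

lemma max_color_fractions_nonempty:
  assumes "k \<ge> 1"
  shows "{max_color_fraction n c | c :: nat set \<Rightarrow> nat. card (c ` K_edges n) \<le> k} \<noteq> {}"
proof -
  have "card ((\<lambda>_. 0 :: nat) ` K_edges n) \<le> k"
    using card_mono[of "{0 :: nat}" "(\<lambda>_. 0) ` K_edges n"] assms
    by (simp add: image_subset_iff)
  then show ?thesis by blast
qed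

lemma bdd_below_min_color_fraction:
  assumes "k \<ge> 1"
  shows "bdd_below (min_color_fraction k ` {2..})"
proof (rule bdd_belowI2)
  fix n :: nat
  assume "n \<in> {2..}"
  then have n: "n \<ge> 2" by simp
  have "min_color_fraction k n
      \<in> {max_color_fraction n c | c :: nat set \<Rightarrow> nat. card (c ` K_edges n) \<le> k}"
    unfolding min_color_fraction_def
    by (rule Min_in[OF finite_max_color_fractions[OF n] max_color_fractions_nonempty[OF assms]])
  then obtain c :: "nat set \<Rightarrow> nat" where "min_color_fraction k n = max_color_fraction n c"
    by blast
  with max_color_fraction_in[OF n, of c] show "0 \<le> min_color_fraction k n"
    by auto
qed

lemma min_color_fraction_le:
  fixes c :: "nat set \<Rightarrow> 'c"
  assumes n: "n \<ge> 2" and k: "card (c ` K_edges n) \<le> k"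
  shows "min_color_fraction k n \<le> max_color_fraction n c"
proof -
  have "finite (c ` K_edges n)" by simp
  from ex_bij_betw_finite_nat[OF this]
  obtain f :: "'c \<Rightarrow> nat" where f: "inj_on f (c ` K_edges n)"
    by (elim exE) (rule that, erule bij_betw_imp_inj_on)
  define d where "d = (\<lambda>e. f (c e))"
  have d_image: "d ` K_edges n = f ` c ` K_edges n"
    by (simp only: d_def image_image)
  have "color_fraction n d (f s) = color_fraction n c s" if s: "s \<in> c ` K_edges n" for s
  proof -
    have *: "d e = f s \<longleftrightarrow> c e = s" if "e \<in> K_edges n" for e
      unfolding d_def by (rule inj_on_eq_iff[OF f imageI[OF that] s])
    have "{v \<in> {..<n}. \<exists>e \<in> K_edges n. v \<in> e \<and> d e = f s}
        = {v \<in> {..<n}. \<exists>e \<in> K_edges n. v \<in> e \<and> c e = s}"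
      by (simp add: * cong: bex_cong)
    then show ?thesis
      by (simp only: color_fraction_def)
  qed
  then have "color_fraction n d ` (d ` K_edges n) = color_fraction n c ` (c ` K_edges n)"
    unfolding d_image image_image[of "color_fraction n d" f] by (rule image_cong[OF refl])
  then have eq: "max_color_fraction n d = max_color_fraction n c"
    by (simp only: max_color_fraction_def)
  have "card (d ` K_edges n) \<le> k"
    unfolding d_image card_image[OF f] by (rule k)
  then have "max_color_fraction n d
      \<in> {max_color_fraction n c | c :: nat set \<Rightarrow> nat. card (c ` K_edges n) \<le> k}"
    by blast
  then show ?thesis
    unfolding min_color_fraction_def eq[symmetric]
    by (rule Min_le[OF finite_max_color_fractions[OF n]])
qed

end

theory Submission
  imports Defs
begin

text \<open>
  Record for each vertex the set of colors at it. Any two of these sets intersect, because the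
  edge joining the two vertices has a color that occurs at both. So the problem is about an
  intersecting family \<open>F\<close> on five points, and it suffices to find weights on the five
  colors for which every member of \<open>F\<close> carries at least \<open>5/9\<close> of the total
  weight. Counting the incidences between vertices and colors with these weights then shows that
  the weighted average of the color fractions is at least \<open>5/9\<close>, and hence so is one of
  the fractions.

  The weights depend on the small members of \<open>F\<close>. A singleton \<open>{a}\<close> forces
  \<open>a\<close> into every member, and \<open>a\<close> gets all the weight. The two-element
  members form an intersecting graph, so they form a triangle or a star. For a triangle, every
  member contains two of its three corners, and equal weights on the corners give \<open>2/3\<close>
  (\<open>heavy_if_triangle\<close>). For a star with center \<open>a\<close> and set of leaves
  \<open>L\<close>, a member without \<open>a\<close> contains all of \<open>L\<close>, and a member
  with \<open>a\<close> contains a leaf or has at least three elements; weights that are constant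
  on \<open>{a}\<close>, on \<open>L\<close> and on the rest are enough (\<open>heavy_if_star\<close>).
  The extreme case is a star with two leaves, with weights \<open>3\<close>; \<open>2\<close>,
  \<open>2\<close>; \<open>1\<close>, \<open>1\<close> of total \<open>9\<close>, in which the
  lightest members have weight \<open>5\<close>.
\<close>

section \<open>Weights for intersecting families on five points\<close>

definition heavy_for_some_weights :: "'a set \<Rightarrow> 'a set set \<Rightarrow> bool" where
  "heavy_for_some_weights S F \<longleftrightarrow>
     (\<exists>p :: 'a \<Rightarrow> nat. 0 < sum p S \<and> (\<forall>A\<in>F. 5 * sum p S \<le> 9 * sum p A))"

lemma heavy_if_singleton:
  assumes S: "finite S" "F \<subseteq> Pow S"
    and int: "\<And>A B. A \<in> F \<Longrightarrow> B \<in> F \<Longrightarrow> A \<inter> B \<noteq> {}"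
    and a: "{a} \<in> F"
  shows "heavy_for_some_weights S F"
  unfolding heavy_for_some_weights_def
proof (intro exI[of _ "\<lambda>x. if x = a then 1 else 0"] conjI ballI)
  have "a \<in> S" using S a by auto
  then have 1: "(\<Sum>x\<in>S. if x = a then 1 else 0 :: nat) = 1" using S by simp
  then show "0 < (\<Sum>x\<in>S. if x = a then 1 else 0 :: nat)" by simp
  fix A assume A: "A \<in> F"
  then have "a \<in> A" "finite A" using int[OF A a] S A by (auto intro: finite_subset)
  then show "5 * (\<Sum>x\<in>S. if x = a then 1 else 0 :: nat) \<le> 9 * (\<Sum>x\<in>A. if x = a then 1 else 0)"
    unfolding 1 by simp
qed

lemma heavy_if_triangle:
  assumes S: "finite S" "F \<subseteq> Pow S"
    and int: "\<And>A B. A \<in> F \<Longrightarrow> B \<in> F \<Longrightarrow> A \<inter> B \<noteq> {}"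
    and xyz: "{x, y} \<in> F" "{y, z} \<in> F" "{x, z} \<in> F" "x \<noteq> y" "y \<noteq> z" "x \<noteq> z"
  shows "heavy_for_some_weights S F"
  unfolding heavy_for_some_weights_def
proof (intro exI[of _ "\<lambda>u. if u \<in> {x, y, z} then 1 else 0"] conjI ballI)
  let ?p = "\<lambda>u. if u \<in> {x, y, z} then 1 else 0 :: nat"
  have p: "sum ?p A = card (A \<inter> {x, y, z})" if "A \<subseteq> S" for A
    using that S finite_subset[of A S] by (subst sum.inter_restrict[symmetric]) auto
  have "S \<inter> {x, y, z} = {x, y, z}" using S xyz by auto
  then have 3: "sum ?p S = 3" using p[of S] xyz by simp
  then show "0 < sum ?p S" by simp
  fix A assume A: "A \<in> F"
  from int[OF A xyz(1)] int[OF A xyz(2)] int[OF A xyz(3)]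
  have "{x, y} \<subseteq> A \<inter> {x, y, z} \<or> {y, z} \<subseteq> A \<inter> {x, y, z} \<or> {x, z} \<subseteq> A \<inter> {x, y, z}"
    by auto
  moreover have "card B \<le> card (A \<inter> {x, y, z})" if "B \<subseteq> A \<inter> {x, y, z}" for B
    using that by (intro card_mono) auto
  ultimately have "2 \<le> card (A \<inter> {x, y, z})"
    using xyz by (metis card_2_iff)
  moreover have "A \<subseteq> S" using A S by auto
  ultimately show "5 * sum ?p S \<le> 9 * sum ?p A" unfolding 3 using p[of A] by simp
qed

text \<open>
  The weights for a star on five points with \<open>l\<close> leaves: \<open>\<alpha>\<close> at the
  center, \<open>\<beta>\<close> at each leaf and \<open>\<gamma>\<close> at each of the remaining
  \<open>4 - l\<close> points. A member of the family meets the leaves in \<open>x\<close> points and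
  the remaining points in \<open>y\<close>; the two bounds treat members with and without the
  center.
\<close>

lemma star_weights:
  assumes "l \<le> (4 :: nat)"
  obtains \<alpha> \<beta> \<gamma> :: nat where "0 < \<alpha>"
    "\<And>x y. x \<le> l \<Longrightarrow> y \<le> 4 - l \<Longrightarrow> 1 \<le> x \<or> 2 \<le> y \<Longrightarrow>
       5 * (\<alpha> + \<beta> * l + \<gamma> * (4 - l)) \<le> 9 * (\<alpha> + \<beta> * x + \<gamma> * y)"
    "\<And>y. 3 \<le> l + y \<Longrightarrow>
       5 * (\<alpha> + \<beta> * l + \<gamma> * (4 - l)) \<le> 9 * (\<beta> * l + \<gamma> * y)"
proof -
  consider "l = 0" | "l = 1" | "l = 2" | "l = 3" | "l = 4" using assms by linarith
  then show thesis
  proof cases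
    case 1 then show thesis by (intro that[of 1 1 1]) auto
  next
    case 2 then show thesis by (intro that[of 2 2 1]) auto
  next
    case 3 then show thesis by (intro that[of 3 2 1]) auto
  next
    case 4 then show thesis by (intro that[of 2 1 0]) auto
  next
    case 5 then show thesis by (intro that[of 3 1 0]) auto
  qed
qed

text \<open>
  The star may have no leaves: if all members have at least three elements, any point serves as
  the center \<open>a\<close>.
\<close>

lemma heavy_if_star:
  assumes S: "card S = 5" "F \<subseteq> Pow S" "a \<in> S"
    and int: "\<And>A B. A \<in> F \<Longrightarrow> B \<in> F \<Longrightarrow> A \<inter> B \<noteq> {}"
    and two: "\<And>A. A \<in> F \<Longrightarrow> 2 \<le> card A"
    and star: "\<And>A. A \<in> F \<Longrightarrow> card A = 2 \<Longrightarrow> a \<in> A"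
  shows "heavy_for_some_weights S F"
proof -
  define L where "L = {x \<in> S - {a}. {a, x} \<in> F}"
  define R where "R = S - {a} - L"
  have fin: "finite S" using S(1) by (metis card.infinite zero_neq_numeral)
  have LR: "finite L" "finite R" "a \<notin> L" "a \<notin> R" "L \<inter> R = {}" "S = {a} \<union> (L \<union> R)"
    using fin S(3) unfolding L_def R_def by auto
  have "card L + card R = card (L \<union> R)" using LR by (simp add: card_Un_disjoint)
  moreover have "card S = Suc (card (L \<union> R))" using LR by simp
  ultimately have cards: "card L \<le> 4" "card R = 4 - card L" using S(1) by auto
  obtain \<alpha> \<beta> \<gamma> where w: "0 < \<alpha>"
    "\<And>x y. x \<le> card L \<Longrightarrow> y \<le> 4 - card L \<Longrightarrow> 1 \<le> x \<or> 2 \<le> y \<Longrightarrow>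
       5 * (\<alpha> + \<beta> * card L + \<gamma> * (4 - card L)) \<le> 9 * (\<alpha> + \<beta> * x + \<gamma> * y)"
    "\<And>y. 3 \<le> card L + y \<Longrightarrow>
       5 * (\<alpha> + \<beta> * card L + \<gamma> * (4 - card L)) \<le> 9 * (\<beta> * card L + \<gamma> * y)"
    using star_weights[OF cards(1)] by blast
  define p where "p x = (if x = a then \<alpha> else if x \<in> L then \<beta> else \<gamma>)" for x
  have split: "sum f A = (if a \<in> A then f a else 0) + (sum f (A \<inter> L) + sum f (A \<inter> R))"
    if "A \<subseteq> S" for A and f :: "_ \<Rightarrow> nat"
  proof -
    have "sum f A = sum f (A \<inter> {a}) + sum f (A \<inter> (L \<union> R))"
      using that LR by (subst sum.union_disjoint[symmetric]) (auto intro!: sum.cong)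
    also have "sum f (A \<inter> (L \<union> R)) = sum f (A \<inter> L) + sum f (A \<inter> R)"
      using LR by (subst sum.union_disjoint[symmetric]) (auto intro!: sum.cong)
    finally show ?thesis by auto
  qed
  have p: "sum p A = (if a \<in> A then \<alpha> else 0) + (\<beta> * card (A \<inter> L) + \<gamma> * card (A \<inter> R))"
    if "A \<subseteq> S" for A
  proof -
    have "sum p (A \<inter> L) = (\<Sum>_\<in>A \<inter> L. \<beta>)" "sum p (A \<inter> R) = (\<Sum>_\<in>A \<inter> R. \<gamma>)"
      using LR by (auto simp: p_def simp del: sum_constant intro!: sum.cong)
    then show ?thesis using split[OF that, of p] by (simp add: p_def)
  qed
  have card: "card A = (if a \<in> A then 1 else 0) + (card (A \<inter> L) + card (A \<inter> R))"
    if "A \<subseteq> S" for A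
    using split[OF that, of "\<lambda>_. 1"] by simp
  have "S \<inter> L = L" "S \<inter> R = R" using LR by auto
  then have pS: "sum p S = \<alpha> + \<beta> * card L + \<gamma> * (4 - card L)"
    using p[of S] S(3) cards by simp
  have "5 * sum p S \<le> 9 * sum p A" if A: "A \<in> F" for A
  proof (cases "a \<in> A")
    case True
    have AS: "A \<subseteq> S" using A S by auto
    have "1 \<le> card (A \<inter> L) \<or> 2 \<le> card (A \<inter> R)"
    proof (rule ccontr)
      assume neg: "\<not> ?thesis"
      then have no_leaf: "A \<inter> L = {}" using LR by (simp add: Suc_le_eq card_gt_0_iff)
      have "card A = 2" using card[OF AS] neg two[OF A] True by simp
      then obtain x where x: "A = {a, x}" "x \<noteq> a" using True by (auto simp: card_2_iff)
      then have "x \<in> L" using A AS by (auto simp: L_def)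
      then show False using no_leaf x by auto
    qed
    moreover have "card (A \<inter> L) \<le> card L" using LR by (intro card_mono) auto
    moreover have "card (A \<inter> R) \<le> 4 - card L"
      unfolding cards(2)[symmetric] using LR by (intro card_mono) auto
    ultimately show ?thesis using w(2) p[OF AS] True unfolding pS by (simp add: add.assoc)
  next
    case False
    have AS: "A \<subseteq> S" using A S by auto
    have "L \<subseteq> A" using int[OF A] False by (auto simp: L_def)
    then have AL: "A \<inter> L = L" by auto
    have "card A \<noteq> 2" using star[OF A] False by auto
    then have "3 \<le> card A" using two[OF A] by simp
    then have "3 \<le> card L + card (A \<inter> R)" using card[OF AS] False AL by simp
    then show ?thesis using w(3) p[OF AS] False AL unfolding pS by simp
  qed
  moreover have "0 < sum p S" using pS w(1) by simp
  ultimately show ?thesis unfolding heavy_for_some_weights_def by blast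
qed

text \<open>
  Two-element members without a common point contain a triangle: a pair \<open>{x, y}\<close>, a
  pair missing \<open>x\<close> and a pair missing \<open>y\<close> can only intersect each other
  if they are the three pairs in a three-element set.
\<close>

lemma heavy_if_intersecting:
  assumes S: "card S = 5" "F \<subseteq> Pow S"
    and int: "\<And>A B. A \<in> F \<Longrightarrow> B \<in> F \<Longrightarrow> A \<inter> B \<noteq> {}"
  shows "heavy_for_some_weights S F"
proof -
  have fin: "finite S" using S(1) by (metis card.infinite zero_neq_numeral)
  show ?thesis
  proof (cases "\<exists>A\<in>F. card A < 2")
    case True
    then obtain A where A: "A \<in> F" "card A < 2" by auto
    have "A \<subseteq> S" using A(1) S(2) by auto
    then have "finite A" "A \<noteq> {}" using A(1) fin int[of A A] by (auto intro: finite_subset)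
    then have "card A = 1" using A(2) by (metis One_nat_def card_0_eq less_2_cases)
    then obtain a where "A = {a}" by (auto simp: card_1_singleton_iff)
    then show ?thesis using heavy_if_singleton[OF fin S(2) int] A(1) by blast
  next
    case False
    then have two: "\<And>A. A \<in> F \<Longrightarrow> 2 \<le> card A" by force
    show ?thesis
    proof (cases "\<exists>a\<in>S. \<forall>A\<in>F. card A = 2 \<longrightarrow> a \<in> A")
      case True
      then show ?thesis using heavy_if_star[OF S _ int two] by blast
    next
      case False
      then have miss: "\<And>a. a \<in> S \<Longrightarrow> \<exists>A\<in>F. card A = 2 \<and> a \<notin> A" by auto
      obtain s where "s \<in> S" using S(1) by fastforce
      then obtain x y where xy: "{x, y} \<in> F" "x \<noteq> y" using miss by (metis card_2_iff)
      then have "x \<in> S" "y \<in> S" using S by auto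
      obtain A where A: "A \<in> F" "card A = 2" "x \<notin> A" using miss[OF \<open>x \<in> S\<close>] by auto
      obtain B where B: "B \<in> F" "card B = 2" "y \<notin> B" using miss[OF \<open>y \<in> S\<close>] by auto
      have "y \<in> A" "x \<in> B" using int[OF A(1) xy(1)] int[OF B(1) xy(1)] A(3) B(3) by auto
      then obtain z z' where z: "A = {y, z}" "y \<noteq> z" and z': "B = {x, z'}" "x \<noteq> z'"
        using A(2) B(2) by (auto simp: card_2_iff)
      have "z' = z" using int[OF A(1) B(1)] A(3) B(3) xy(2) unfolding z(1) z'(1) by auto
      then show ?thesis
        using heavy_if_triangle[OF fin S(2) int, of x y z] xy z z' A(1) B(1) by blast
    qed
  qed
qed

section \<open>From weights to edge-colorings\<close>

text \<open>
  Since the color sets \<open>C v\<close> carry at least \<open>5/9\<close> of the weight, the sum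
  over all vertices \<open>v\<close> of the weight of \<open>C v\<close> is at least
  \<open>5/9\<close> of \<open>card V\<close> times the total weight. Counted color by color, the
  same sum is the weighted sum of the numbers of vertices at the colors.
\<close>

lemma frequent_color_if_heavy:
  assumes fin: "finite V" "finite S" and C: "\<And>v. v \<in> V \<Longrightarrow> C v \<subseteq> S"
    and heavy: "heavy_for_some_weights S (C ` V)"
  obtains s where "s \<in> S" "5 * card V \<le> 9 * card {v \<in> V. s \<in> C v}"
proof -
  obtain p :: "_ \<Rightarrow> nat" where p: "0 < sum p S" "\<And>v. v \<in> V \<Longrightarrow> 5 * sum p S \<le> 9 * sum p (C v)"
    using heavy by (auto simp: heavy_for_some_weights_def)
  have restrict: "(\<Sum>s\<in>S. if s \<in> C v then p s else 0) = sum p (C v)" if "v \<in> V" for v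
    using C[OF that] fin by (subst sum.inter_restrict[symmetric]) (auto intro!: sum.cong)
  have "(\<Sum>s\<in>S. p s * (5 * card V)) = (\<Sum>v\<in>V. 5 * sum p S)"
    by (simp add: sum_distrib_right[symmetric])
  also have "\<dots> \<le> (\<Sum>v\<in>V. 9 * sum p (C v))" by (intro sum_mono p)
  also have "\<dots> = 9 * (\<Sum>v\<in>V. \<Sum>s\<in>S. if s \<in> C v then p s else 0)"
    by (simp add: sum_distrib_left restrict)
  also have "\<dots> = 9 * (\<Sum>s\<in>S. \<Sum>v\<in>V. if s \<in> C v then p s else 0)"
    by (subst sum.swap) simp
  also have "\<dots> = (\<Sum>s\<in>S. p s * (9 * card {v \<in> V. s \<in> C v}))"
    using fin by (simp add: sum.inter_filter[symmetric] sum_distrib_left mult_ac)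
  finally have le: "(\<Sum>s\<in>S. p s * (5 * card V)) \<le> (\<Sum>s\<in>S. p s * (9 * card {v \<in> V. s \<in> C v}))" .
  obtain t where t: "t \<in> S" "0 < p t"
    using p(1) by (metis gr0I less_numeral_extra(3) sum.neutral)
  show thesis
  proof (rule ccontr)
    assume "\<not> thesis"
    then have rare: "9 * card {v \<in> V. s \<in> C v} < 5 * card V" if "s \<in> S" for s
      using that \<open>\<And>s. s \<in> S \<Longrightarrow> 5 * card V \<le> 9 * card {v \<in> V. s \<in> C v} \<Longrightarrow> thesis\<close>
      by (meson not_le)
    have "(\<Sum>s\<in>S. p s * (9 * card {v \<in> V. s \<in> C v})) < (\<Sum>s\<in>S. p s * (5 * card V))"
    proof (rule sum_strict_mono_ex1[OF fin(2)])
      show "\<forall>s\<in>S. p s * (9 * card {v \<in> V. s \<in> C v}) \<le> p s * (5 * card V)"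
        using rare by (auto intro!: mult_le_mono2 less_imp_le)
      show "\<exists>s\<in>S. p s * (9 * card {v \<in> V. s \<in> C v}) < p s * (5 * card V)"
        using t rare by (intro bexI[of _ t]) auto
    qed
    then show False using le by simp
  qed
qed

lemma max_color_fraction_five_colors:
  fixes c :: "nat set \<Rightarrow> nat"
  assumes n: "n \<ge> 2" and k: "card (c ` K_edges n) \<le> 5"
  shows "5 / 9 \<le> max_color_fraction n c"
proof -
  define C where "C v = {c e | e. e \<in> K_edges n \<and> v \<in> e}" for v
  obtain S where S: "c ` K_edges n \<subseteq> S" "card S = 5" "finite S"
  proof -
    obtain T where T: "finite T" "card T = 5 - card (c ` K_edges n)" "T \<subseteq> UNIV - c ` K_edges n"
      using infinite_arbitrarily_large[of "UNIV - c ` K_edges n" "5 - card (c ` K_edges n)"]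
      by (auto intro: Diff_infinite_finite)
    have "card (c ` K_edges n \<union> T) = card (c ` K_edges n) + card T"
      using T by (intro card_Un_disjoint) auto
    then show thesis using T k by (intro that[of "c ` K_edges n \<union> T"]) auto
  qed
  have CS: "C v \<subseteq> S" for v using S by (auto simp: C_def)
  have edge: "\<exists>e\<in>K_edges n. u \<in> e \<and> v \<in> e" if "u < n" "v < n" for u v
  proof -
    \<comment> \<open>For \<open>u = v\<close> any edge at \<open>u\<close> will do; one exists as \<open>n \<ge> 2\<close>.\<close>
    obtain w where w: "w < n" "w \<noteq> u" "u \<noteq> v \<longrightarrow> w = v"
    proof (cases "u = v")
      case True
      show thesis using n True by (intro that[of "if u = 0 then 1 else 0"]) auto
    next
      case False
      then show thesis using that \<open>v < n\<close> by (intro that[of v]) auto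
    qed
    then have "{u, w} \<in> K_edges n"
      using \<open>u < n\<close> unfolding K_edges_def by (subst doubleton_in_nsets_2) auto
    then show ?thesis using w by blast
  qed
  have "C u \<inter> C v \<noteq> {}" if "u < n" "v < n" for u v
    using edge[OF that] unfolding C_def by blast
  then have "heavy_for_some_weights S (C ` {..<n})"
    using CS by (intro heavy_if_intersecting[OF S(2)]) auto
  then obtain s where s: "5 * n \<le> 9 * card {v \<in> {..<n}. s \<in> C v}"
    using frequent_color_if_heavy[of "{..<n}" S C] S(3) CS by (metis card_lessThan finite_lessThan)
  have eq: "{v \<in> {..<n}. s \<in> C v} = {v \<in> {..<n}. \<exists>e\<in>K_edges n. v \<in> e \<and> c e = s}"
    by (auto simp: C_def)
  have "{v \<in> {..<n}. s \<in> C v} \<noteq> {}"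
  proof
    assume "{v \<in> {..<n}. s \<in> C v} = {}"
    then show False using s n by (simp only: card.empty)
  qed
  then have "s \<in> c ` K_edges n" by (auto simp: C_def)
  then have "color_fraction n c s \<le> max_color_fraction n c"
    unfolding max_color_fraction_def by (intro Max_ge) auto
  moreover have "5 / 9 \<le> color_fraction n c s"
  proof -
    have "real (5 * n) \<le> real (9 * card {v \<in> {..<n}. s \<in> C v})" using s by (rule of_nat_mono)
    then show ?thesis using n unfolding color_fraction_def eq by (simp add: field_simps)
  qed
  ultimately show ?thesis by simp
qed

theorem proposition2p8:
  shows "z_inf 5 \<ge> 5 / 9"
  unfolding z_inf_def
proof (rule cINF_greatest)
  show "{2 :: nat..} \<noteq> {}" by simp
  fix n :: nat assume "n \<in> {2..}"
  then have n: "n \<ge> 2" by simp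
  have "min_color_fraction 5 n
      \<in> {max_color_fraction n c | c :: nat set \<Rightarrow> nat. card (c ` K_edges n) \<le> 5}"
    unfolding min_color_fraction_def
    by (rule Min_in[OF finite_max_color_fractions[OF n] max_color_fractions_nonempty]) simp
  then show "5 / 9 \<le> min_color_fraction 5 n"
    using max_color_fraction_five_colors[OF n] by auto
qed

end
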